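(* Let $S\subseteq\mathbb{R}^d$ and $S_1\subseteq S$ be such that $0\in\operatorname{Conv}(S\smallsetminus\{s\})$ for every $s\in S_1$. Then there exists a subset $S'\subseteq S$ of cardinality at most $(d+1)(d+2)$ such that $0\in\operatorname{Conv}(S'\smallsetminus\{s\})$ for every $s\in S_1$.
   Context: $\operatorname{Conv}$ denotes the convex hull in $\mathbb{R}^d$. *)

theory Defs
  imports "HOL-Analysis.Analysis"
begin

end

(* Caratheodory yields T in S with at most d+1 points and 0 in Conv T. Only the at most d+1 points s
   of T can fail, and each is repaired by adding a Caratheodory set inside S - {s}:
   (d+1) + (d+1)(d+1) = (d+1)(d+2). *)

theory Submission
  imports Defs
begin

theorem theorem5p1:
  fixes S S\<^sub>1 :: "(real ^ 'd) set"
  assumes "S\<^sub>1 \<subseteq> S"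
    and "\<And>s. s \<in> S\<^sub>1 \<Longrightarrow> 0 \<in> convex hull (S - {s})"
  shows "\<exists>S'. S' \<subseteq> S \<and> finite S' \<and> card S' \<le> (CARD('d) + 1) * (CARD('d) + 2)
           \<and> (\<forall>s\<in>S\<^sub>1. 0 \<in> convex hull (S' - {s}))"
\<comment> \<open>If \<open>S\<^sub>1\<close> is empty, the hypotheses put 0 in no hull, so there is
  no base set to start from; the claim is then vacuous.\<close>
proof (cases "S\<^sub>1 = {}")
  case True
  then show ?thesis by (intro exI[of _ "{}"]) auto
next
  case False
  let ?n = "CARD('d) + 1"
  have "\<forall>s\<in>S\<^sub>1. \<exists>T. finite T \<and> T \<subseteq> S - {s} \<and> card T \<le> ?n \<and> 0 \<in> convex hull T"
  proof
    fix s assume "s \<in> S\<^sub>1"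
    then have "0 \<in> convex hull (S - {s})" by (rule assms(2))
    then show "\<exists>T. finite T \<and> T \<subseteq> S - {s} \<and> card T \<le> ?n \<and> 0 \<in> convex hull T"
      \<comment> \<open>The bound is the dimension of \<open>real ^ 'd\<close> plus one, which
        \<open>simp\<close> evaluates to \<open>?n\<close>.\<close>
      by (subst (asm) caratheodory) simp
  qed
  then obtain T where T: "\<And>s. s \<in> S\<^sub>1 \<Longrightarrow>
      finite (T s) \<and> T s \<subseteq> S - {s} \<and> card (T s) \<le> ?n \<and> 0 \<in> convex hull (T s)"
    by metis
  obtain s0 where s0: "s0 \<in> S\<^sub>1" using False by blast
  \<comment> \<open>The set chosen for an arbitrary \<open>s0\<close> serves as the base. Deleting
    \<open>s\<close> can harm it only if \<open>s\<close> belongs to it, so \<open>R\<close>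
    collects the points that need a repair.\<close>
  define R where "R = T s0 \<inter> S\<^sub>1"
  define S' where "S' = T s0 \<union> (\<Union>s\<in>R. T s)"
  have R: "finite R" "card R \<le> ?n"
    using T[OF s0] card_mono[of "T s0" R] by (auto simp: R_def)
  have "card (\<Union>s\<in>R. T s) \<le> (\<Sum>s\<in>R. card (T s))"
    by (rule card_UN_le[OF R(1)])
  also have "\<dots> \<le> card R * ?n"
    using sum_bounded_above[of R "\<lambda>s. card (T s)" ?n] T by (auto simp: R_def)
  also have "\<dots> \<le> ?n * ?n"
    using R(2) by (rule mult_le_mono1)
  finally have "card S' \<le> ?n + ?n * ?n"
    using T[OF s0] card_Un_le[of "T s0" "\<Union>s\<in>R. T s"] unfolding S'_def by linarith
  then have "card S' \<le> ?n * (CARD('d) + 2)"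
    by (simp add: algebra_simps)
  moreover have "S' \<subseteq> S" "finite S'"
    using T s0 R(1) by (auto simp: S'_def R_def)
  moreover have "0 \<in> convex hull (S' - {s})" if s: "s \<in> S\<^sub>1" for s
  proof (cases "s \<in> T s0")
    case True
    \<comment> \<open>Here \<open>s\<close> lies in \<open>R\<close>, so \<open>S'\<close> contains
      its repair set, which survives the deletion because it was chosen inside
      \<open>S - {s}\<close>.\<close>
    then have "T s \<subseteq> S' - {s}" using T[OF s] s by (auto simp: S'_def R_def)
    then show ?thesis using T[OF s] hull_mono by blast
  next
    case False
    \<comment> \<open>The base set avoids \<open>s\<close> and needs no repair.\<close>
    then have "T s0 \<subseteq> S' - {s}" by (auto simp: S'_def)
    then show ?thesis using T[OF s0] hull_mono by blast
  qed
  ultimately show ?thesis by blast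
qed

end
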